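(* Let $p\ge1$ be real and $\mathcal{U}=\{h\in\mathbb{R}^m_+:\|h\|_p\le1\}$. Put $$\beta=\frac1p(p-1)^{\frac{p-1}{p}}\cdot m^{\frac{p-1}{p^2}}=O\big(m^{\frac{p-1}{p^2}}\big).$$ Then the set $2\beta\cdot\mathrm{conv}\big(e_1,\dots,e_m,m^{-1/p}e\big)$ dominates $\mathcal{U}$, and the piecewise affine solution described in the context (with this $\beta$ and $\gamma=m^{-1/p}$) gives an $O\big(m^{\frac{p-1}{p^2}}\big)$-approximation to $\Pi_{AR}(\mathcal{U})$, i.e. a $C\,m^{\frac{p-1}{p^2}}$-approximation for a constant $C$ independent of $m$ and of the data $(A,B,c,d)$.
   Context: Vector inequalities are componentwise; $e_i$ is the $i$-th standard basis vector and $e$ the all-ones vector of $\mathbb{R}^m$; $(a)^+=\max(a,0)$; $\mathrm{conv}$ denotes convex hull; $0^0=1$ (relevant when $p=1$). Two-stage adjustable robust problem $\Pi_{AR}(\mathcal{S})$: the data are $A\in\mathbb{R}_+^{m\times n}$, $B\in\mathbb{R}^{m\times n}$, $c,d\in\mathbb{R}^n_+$. For a set $\mathcal{S}\subseteq\mathbb{R}^m_+$, a feasible solution is a pair $(x,y(\cdot))$ with $x\in\mathbb{R}^n_+$, $y:\mathcal{S}\to\mathbb{R}^n_+$ and $Ax+By(h)\ge h$ for all $h\in\mathcal{S}$; the optimal value $z_{AR}(\mathcal{S})$ is the minimum (infimum) over feasible solutions of the worst-case cost $c^Tx+\max_{h\in\mathcal{S}}d^Ty(h)$ (max read as supremum;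 value $+\infty$ if infeasible). An optimal solution is a feasible solution whose worst-case cost equals $z_{AR}(\mathcal{S})<\infty$. A solution $(x,y(\cdot))$ gives an $\alpha$-approximation for $\Pi_{AR}(\mathcal{U})$ if it is feasible for $\Pi_{AR}(\mathcal{U})$ and $c^Tx+d^Ty(h)\le\alpha\cdot z_{AR}(\mathcal{U})$ for all $h\in\mathcal{U}$. Domination: $\hat{\mathcal{U}}\subseteq\mathbb{R}^m_+$ dominates $\mathcal{U}$ if for every $h\in\mathcal{U}$ there is $\hat h\in\hat{\mathcal{U}}$ with $\hat h\ge h$. Piecewise affine solution with parameters $\beta,\gamma$: let $(\hat x,\hat y(\cdot))$ be an optimal solution (assumed to exist) of $\Pi_{AR}$ over $\beta\cdot\mathrm{conv}(e_1,\dots,e_m,\gamma e)$. The piecewise affine solution is $x=2\hat x$, $y(h)=\frac1\beta\sum_{i=1}^m(h_i-\beta\gamma)^+\hat y(\beta e_i)+\hat y(\beta\gamma e)$ for $h\in\mathcal{U}$. *)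

theory Defs
  imports
    "Jordan_Normal_Form.Matrix"
    "HOL-Library.Extended_Real"
    "HOL-Library.Landau_Symbols"
begin

(* The constant in the approximation guarantee is uniform in the dimensions, so the dimensions
   are term-level naturals: vectors of length m are elements of carrier_vec m. The order on
   vectors is the componentwise one; indices run over {..<m}. *)

definition nonneg_orthant :: "nat \<Rightarrow> real vec set" where
  "nonneg_orthant m = {v \<in> carrier_vec m. 0\<^sub>v m \<le> v}"

definition ones_vec :: "nat \<Rightarrow> real vec" where
  "ones_vec m = vec m (\<lambda>_. 1)"

definition convex_vec :: "nat \<Rightarrow> real vec set \<Rightarrow> bool" where
  "convex_vec m S \<longleftrightarrow> S \<subseteq> carrier_vec m \<and>
     (\<forall>v\<in>S. \<forall>w\<in>S. \<forall>s t. 0 \<le> s \<longrightarrow> 0 \<le> t \<longrightarrow> s + t = 1 \<longrightarrow> s \<cdot>\<^sub>v v + t \<cdot>\<^sub>v w \<in> S)"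

definition scale_set :: "real \<Rightarrow> real vec set \<Rightarrow> real vec set" where
  "scale_set r S = (\<lambda>v. r \<cdot>\<^sub>v v) ` S"

(* conv(e_1, ..., e_m, gamma e) *)
definition simplex_conv :: "nat \<Rightarrow> real \<Rightarrow> real vec set" where
  "simplex_conv m \<gamma> = convex_vec m hull ({unit_vec m i | i. i < m} \<union> {\<gamma> \<cdot>\<^sub>v ones_vec m})"

definition p_norm :: "real \<Rightarrow> real vec \<Rightarrow> real" where
  "p_norm p v = (\<Sum>i<dim_vec v. \<bar>v $ i\<bar> powr p) powr (1 / p)"

definition p_ball :: "real \<Rightarrow> nat \<Rightarrow> real vec set" where
  "p_ball p m = {h \<in> nonneg_orthant m. p_norm p h \<le> 1}"

definition dominates :: "nat \<Rightarrow> real vec set \<Rightarrow> real vec set \<Rightarrow> bool" where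
  "dominates m V U \<longleftrightarrow> V \<subseteq> nonneg_orthant m \<and> (\<forall>h\<in>U. \<exists>h'\<in>V. h \<le> h')"

definition ar_data ::
  "nat \<Rightarrow> nat \<Rightarrow> real mat \<Rightarrow> real mat \<Rightarrow> real vec \<Rightarrow> real vec \<Rightarrow> bool" where
  "ar_data m n A B c d \<longleftrightarrow>
     A \<in> carrier_mat m n \<and> (\<forall>i<m. \<forall>j<n. 0 \<le> A $$ (i, j)) \<and>
     B \<in> carrier_mat m n \<and> c \<in> nonneg_orthant n \<and> d \<in> nonneg_orthant n"

(* The second-stage policy y is a total function; only its values on S matter. *)
definition ar_feasible ::
  "real mat \<Rightarrow> real mat \<Rightarrow> real vec set \<Rightarrow> real vec \<Rightarrow> (real vec \<Rightarrow> real vec) \<Rightarrow> bool" where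
  "ar_feasible A B S x y \<longleftrightarrow>
     x \<in> nonneg_orthant (dim_col A) \<and>
     (\<forall>h\<in>S. y h \<in> nonneg_orthant (dim_col B) \<and> h \<le> A *\<^sub>v x + B *\<^sub>v y h)"

definition ar_cost ::
  "real vec \<Rightarrow> real vec \<Rightarrow> real vec set \<Rightarrow> real vec \<Rightarrow> (real vec \<Rightarrow> real vec) \<Rightarrow> ereal" where
  "ar_cost c d S x y = ereal (c \<bullet> x) + (SUP h\<in>S. ereal (d \<bullet> y h))"

(* Inf {} = \<infinity> in ereal, the required value for an infeasible problem. *)
definition z_AR ::
  "real mat \<Rightarrow> real mat \<Rightarrow> real vec \<Rightarrow> real vec \<Rightarrow> real vec set \<Rightarrow> ereal" where
  "z_AR A B c d S = Inf {ar_cost c d S x y | x y. ar_feasible A B S x y}"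

definition ar_optimal ::
  "real mat \<Rightarrow> real mat \<Rightarrow> real vec \<Rightarrow> real vec \<Rightarrow> real vec set \<Rightarrow>
   real vec \<Rightarrow> (real vec \<Rightarrow> real vec) \<Rightarrow> bool" where
  "ar_optimal A B c d S x y \<longleftrightarrow>
     ar_feasible A B S x y \<and> ar_cost c d S x y = z_AR A B c d S \<and> z_AR A B c d S < \<infinity>"

definition ar_approximation ::
  "real \<Rightarrow> real mat \<Rightarrow> real mat \<Rightarrow> real vec \<Rightarrow> real vec \<Rightarrow> real vec set \<Rightarrow>
   real vec \<Rightarrow> (real vec \<Rightarrow> real vec) \<Rightarrow> bool" where
  "ar_approximation \<alpha> A B c d U x y \<longleftrightarrow>
     ar_feasible A B U x y \<and>
     (\<forall>h\<in>U. ereal (c \<bullet> x + d \<bullet> y h) \<le> ereal \<alpha> * z_AR A B c d U)"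

definition pw_affine_x :: "real vec \<Rightarrow> real vec" where
  "pw_affine_x xh = 2 \<cdot>\<^sub>v xh"

definition pw_affine_y ::
  "nat \<Rightarrow> nat \<Rightarrow> real \<Rightarrow> real \<Rightarrow> (real vec \<Rightarrow> real vec) \<Rightarrow> real vec \<Rightarrow> real vec" where
  "pw_affine_y m n \<beta> \<gamma> yh h =
     (1 / \<beta>) \<cdot>\<^sub>v finsum_vec TYPE(real) n
        (\<lambda>i. max (h $ i - \<beta> * \<gamma>) 0 \<cdot>\<^sub>v yh (\<beta> \<cdot>\<^sub>v unit_vec m i)) {..<m}
     + yh ((\<beta> * \<gamma>) \<cdot>\<^sub>v ones_vec m)"

(* The case split implements 0^0 = 1, since 0 powr 0 = 0. *)
definition beta :: "real \<Rightarrow> nat \<Rightarrow> real" where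
  "beta p m = 1 / p * (if p = 1 then 1 else (p - 1) powr ((p - 1) / p))
                * real m powr ((p - 1) / p\<^sup>2)"

definition gamma :: "real \<Rightarrow> nat \<Rightarrow> real" where
  "gamma p m = real m powr (- 1 / p)"

end

(* Young's inequality makes the choice of beta exactly the one for which the excesses
   (h_i - beta gamma)^+ of a point h of the ball sum up to at most beta. Hence h lies below
   sum_i l_i beta e_i + beta gamma e with weights l_i summing up to at most 1; this yields
   domination, feasibility of the piecewise affine solution, and a bound on its cost by twice
   the optimal value over beta conv(...). Conversely conv(...) is contained in the ball, so
   rescaling a solution for the ball by beta bounds that value by beta z_AR(ball). *)

theory Submission
  imports Defs "HOL-Analysis.Convex"
begin

section \<open>The nonnegative orthant and the convex hull of the scaled vertices\<close>

lemma nonneg_orthant_iff: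
  "v \<in> nonneg_orthant m \<longleftrightarrow> dim_vec v = m \<and> (\<forall>i<m. 0 \<le> v $ i)"
  by (auto simp: nonneg_orthant_def less_eq_vec_def)

lemma nonneg_orthant_carrier: "v \<in> nonneg_orthant m \<Longrightarrow> v \<in> carrier_vec m"
  by (simp add: nonneg_orthant_def)

lemma smult_nonneg_orthant: "0 \<le> r \<Longrightarrow> v \<in> nonneg_orthant m \<Longrightarrow> r \<cdot>\<^sub>v v \<in> nonneg_orthant m"
  by (auto simp: nonneg_orthant_iff)

lemma add_nonneg_orthant:
  "v \<in> nonneg_orthant m \<Longrightarrow> w \<in> nonneg_orthant m \<Longrightarrow> v + w \<in> nonneg_orthant m"
  by (auto simp: nonneg_orthant_iff)

lemma convex_vec_nonneg_orthant: "convex_vec m (nonneg_orthant m)"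
  by (auto simp: convex_vec_def nonneg_orthant_carrier intro!: add_nonneg_orthant smult_nonneg_orthant)

lemma simplex_conv_mem:
  "i < m \<Longrightarrow> unit_vec m i \<in> simplex_conv m \<gamma>"
  "\<gamma> \<cdot>\<^sub>v ones_vec m \<in> simplex_conv m \<gamma>"
  by (auto simp: simplex_conv_def intro: hull_inc)

lemma simplex_conv_minimal:
  assumes "convex_vec m S" "\<And>i. i < m \<Longrightarrow> unit_vec m i \<in> S" "\<gamma> \<cdot>\<^sub>v ones_vec m \<in> S"
  shows "simplex_conv m \<gamma> \<subseteq> S"
  unfolding simplex_conv_def using assms by (intro hull_minimal) auto

lemma simplex_conv_nonneg: "0 \<le> \<gamma> \<Longrightarrow> simplex_conv m \<gamma> \<subseteq> nonneg_orthant m"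
  by (intro simplex_conv_minimal convex_vec_nonneg_orthant)
    (auto simp: nonneg_orthant_iff ones_vec_def)

text \<open>The two-point condition passes from the sets that the hull intersects to their
  intersection. Containment in \<open>carrier_vec m\<close> is part of \<open>convex_vec\<close> and
  comes from the inclusion in the orthant, for which \<open>0 \<le> \<gamma>\<close> is
  assumed.\<close>

lemma convex_vec_simplex_conv: "0 \<le> \<gamma> \<Longrightarrow> convex_vec m (simplex_conv m \<gamma>)"
  using simplex_conv_nonneg[of \<gamma> m]
  unfolding convex_vec_def simplex_conv_def hull_def
  by (auto simp: nonneg_orthant_def)

text \<open>Passes from convexity for two points to arbitrary weights on the unit vectors, by
  induction on the support. The weight of the new index \<open>j\<close> is split off and the other
  weights are divided by their sum, so that they sum up to 1 again. If their sum is 0, the vector is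
  the unit vector of \<open>j\<close> itself. Empty support contradicts \<open>sum1\<close>.\<close>

lemma convex_vec_combination:
  assumes S: "convex_vec m S" and unit: "\<And>i. i < m \<Longrightarrow> unit_vec m i \<in> S"
    and F: "finite F" "F \<subseteq> {..<m}"
    and nonneg: "\<And>i. i < m \<Longrightarrow> 0 \<le> l i" and sum1: "(\<Sum>i\<in>F. l i) = 1"
  shows "vec m (\<lambda>i. if i \<in> F then l i else 0) \<in> S"
  using F nonneg sum1
proof (induction F arbitrary: l rule: finite_induct)
  case (insert j F)
  have j: "j < m" using insert by auto
  have sum: "l j + (\<Sum>i\<in>F. l i) = 1" using insert by simp
  have ge: "0 \<le> (\<Sum>i\<in>F. l i)" using insert by (intro sum_nonneg) auto
  show ?case
  proof (cases "(\<Sum>i\<in>F. l i) = 0")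
    case True
    then have "\<forall>i\<in>F. l i = 0"
      using insert by (subst (asm) sum_nonneg_eq_0_iff) auto
    then have "vec m (\<lambda>i. if i \<in> insert j F then l i else 0) = unit_vec m j"
      using True sum j by (intro eq_vecI) auto
    then show ?thesis using unit j by simp
  next
    case False
    define s where "s = (\<Sum>i\<in>F. l i)"
    have s: "s > 0" using False ge by (simp add: s_def)
    have "vec m (\<lambda>i. if i \<in> F then l i / s else 0) \<in> S"
      using insert s by (intro insert.IH) (auto simp flip: sum_divide_distrib, simp add: s_def)
    then have "l j \<cdot>\<^sub>v unit_vec m j + s \<cdot>\<^sub>v vec m (\<lambda>i. if i \<in> F then l i / s else 0) \<in> S"
      using S unit[OF j] s sum insert.prems(2)[OF j]
      unfolding convex_vec_def s_def[symmetric] by (simp add: less_imp_le)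
    also have "l j \<cdot>\<^sub>v unit_vec m j + s \<cdot>\<^sub>v vec m (\<lambda>i. if i \<in> F then l i / s else 0)
        = vec m (\<lambda>i. if i \<in> insert j F then l i else 0)"
      using s j insert.hyps by (intro eq_vecI) auto
    finally show ?thesis .
  qed
qed simp

lemma simplex_conv_combination:
  assumes "0 \<le> \<gamma>" "\<And>i. i < m \<Longrightarrow> 0 \<le> l i" "(\<Sum>i<m. l i) = 1"
  shows "vec m l \<in> simplex_conv m \<gamma>"
proof -
  have "vec m (\<lambda>i. if i \<in> {..<m} then l i else 0) \<in> simplex_conv m \<gamma>"
    using assms by (intro convex_vec_combination convex_vec_simplex_conv simplex_conv_mem) auto
  also have "vec m (\<lambda>i. if i \<in> {..<m} then l i else 0) = vec m l"
    by (intro eq_vecI) auto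
  finally show ?thesis .
qed

section \<open>Domination from a bound on the excesses\<close>

text \<open>A point \<open>h\<close> lies below \<open>\<beta> * l + \<beta> * \<gamma> * e\<close>,
  where the vector \<open>l\<close> of normalised excesses, filled up to total weight 1, belongs to
  the hull. This sum is \<open>2 * \<beta>\<close> times the midpoint of \<open>l\<close> and
  \<open>\<gamma> * e\<close>, which explains the factor 2.\<close>

lemma dominates_simplex_conv:
  assumes m: "1 \<le> m" and b: "0 < \<beta>" and g: "0 \<le> \<gamma>"
    and U: "U \<subseteq> nonneg_orthant m"
    and excess: "\<And>h. h \<in> U \<Longrightarrow> (\<Sum>i<m. max (h $ i - \<beta> * \<gamma>) 0) \<le> \<beta>"
  shows "dominates m (scale_set (2 * \<beta>) (simplex_conv m \<gamma>)) U"
  unfolding dominates_def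
proof (intro conjI ballI)
  show "scale_set (2 * \<beta>) (simplex_conv m \<gamma>) \<subseteq> nonneg_orthant m"
    using simplex_conv_nonneg[OF g, of m] b
    by (auto simp: scale_set_def intro!: smult_nonneg_orthant)
next
  fix h assume h: "h \<in> U"
  define E where "E = (\<Sum>i<m. max (h $ i - \<beta> * \<gamma>) 0)"
  have E: "E \<le> \<beta>" using excess[OF h] by (simp add: E_def)
  \<comment> \<open>The weights may sum up to less than 1; the slack goes to the first basis vector.\<close>
  define l where "l i = max (h $ i - \<beta> * \<gamma>) 0 / \<beta> + (if i = 0 then 1 - E / \<beta> else 0)" for i
  have slack: "0 \<le> 1 - E / \<beta>" using E b by simp
  have l_nonneg: "0 \<le> l i" for i
    using slack b by (auto simp: l_def intro!: add_nonneg_nonneg divide_nonneg_pos)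
  \<comment> \<open>The excesses contribute \<open>E / \<beta>\<close>; since
    \<open>1 \<le> m\<close>, the index 0 is in range and contributes the missing
    \<open>1 - E / \<beta>\<close>.\<close>
  have "(\<Sum>i<m. l i) = 1"
    using m by (simp add: l_def sum.distrib E_def flip: sum_divide_distrib)
  then have "vec m l \<in> simplex_conv m \<gamma>"
    using l_nonneg g by (intro simplex_conv_combination) auto
  then have mem: "(1/2) \<cdot>\<^sub>v vec m l + (1/2) \<cdot>\<^sub>v (\<gamma> \<cdot>\<^sub>v ones_vec m) \<in> simplex_conv m \<gamma>"
    using convex_vec_simplex_conv[OF g, of m] simplex_conv_mem(2)[of \<gamma> m]
    by (auto simp: convex_vec_def)
  have "h \<le> (2 * \<beta>) \<cdot>\<^sub>v ((1/2) \<cdot>\<^sub>v vec m l + (1/2) \<cdot>\<^sub>v (\<gamma> \<cdot>\<^sub>v ones_vec m))"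
    unfolding less_eq_vec_def
  proof (intro conjI allI impI)
    show "dim_vec h = dim_vec ((2 * \<beta>) \<cdot>\<^sub>v ((1/2) \<cdot>\<^sub>v vec m l + (1/2) \<cdot>\<^sub>v (\<gamma> \<cdot>\<^sub>v ones_vec m)))"
      using U h by (auto simp: nonneg_orthant_iff ones_vec_def)
  next
    fix i assume "i < dim_vec ((2 * \<beta>) \<cdot>\<^sub>v ((1/2) \<cdot>\<^sub>v vec m l + (1/2) \<cdot>\<^sub>v (\<gamma> \<cdot>\<^sub>v ones_vec m)))"
    then have i: "i < m" by (simp add: ones_vec_def)
    have "max (h $ i - \<beta> * \<gamma>) 0 / \<beta> \<le> l i" using slack by (simp add: l_def)
    then have "max (h $ i - \<beta> * \<gamma>) 0 \<le> \<beta> * l i" using b by (simp add: divide_le_eq mult.commute)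
    then have "h $ i \<le> \<beta> * l i + \<beta> * \<gamma>" by linarith
    then show "h $ i \<le> ((2 * \<beta>) \<cdot>\<^sub>v ((1/2) \<cdot>\<^sub>v vec m l + (1/2) \<cdot>\<^sub>v (\<gamma> \<cdot>\<^sub>v ones_vec m))) $ i"
      using i by (simp add: ones_vec_def algebra_simps)
  qed
  then show "\<exists>h'\<in>scale_set (2 * \<beta>) (simplex_conv m \<gamma>). h \<le> h'"
    using mem by (auto simp: scale_set_def)
qed

section \<open>Feasibility and cost of the piecewise affine solution\<close>

lemma scalar_prod_nonneg:
  "v \<in> nonneg_orthant n \<Longrightarrow> w \<in> nonneg_orthant n \<Longrightarrow> 0 \<le> v \<bullet> w"
  by (auto simp: scalar_prod_def nonneg_orthant_iff intro!: sum_nonneg)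

lemma row_nonneg_orthant:
  assumes "A \<in> carrier_mat m n" "\<forall>i<m. \<forall>j<n. (0::real) \<le> A $$ (i, j)" "i < m"
  shows "row A i \<in> nonneg_orthant n"
  using assms by (auto simp: nonneg_orthant_iff)

lemma scalar_prod_finsum_vec:
  fixes v :: "'a::comm_semiring_0 vec"
  assumes "finite F" "f \<in> F \<rightarrow> carrier_vec n"
  shows "v \<bullet> finsum_vec TYPE('a) n f F = (\<Sum>k\<in>F. v \<bullet> f k)"
proof -
  have dims: "dim_vec (finsum_vec TYPE('a) n f F) = n" "\<And>k. k \<in> F \<Longrightarrow> dim_vec (f k) = n"
    using assms finsum_vec_closed[of f F n] by (auto simp: Pi_iff)
  have "v \<bullet> finsum_vec TYPE('a) n f F = (\<Sum>i = 0..<n. \<Sum>k\<in>F. v $ i * f k $ i)"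
    using assms by (simp add: scalar_prod_def dims index_finsum_vec sum_distrib_left)
  also have "\<dots> = (\<Sum>k\<in>F. v \<bullet> f k)"
    by (subst sum.swap) (simp add: scalar_prod_def dims)
  finally show ?thesis .
qed

text \<open>Serves two purposes: with \<open>v\<close> a row of \<open>B\<close> it expands a
  constraint, with \<open>v = d\<close> the second-stage cost.\<close>

lemma scalar_prod_pw_affine_y:
  assumes "v \<in> carrier_vec n" "\<And>i. i < m \<Longrightarrow> yh (\<beta> \<cdot>\<^sub>v unit_vec m i) \<in> carrier_vec n"
    and "yh ((\<beta> * \<gamma>) \<cdot>\<^sub>v ones_vec m) \<in> carrier_vec n"
  shows "v \<bullet> pw_affine_y m n \<beta> \<gamma> yh h =
      (\<Sum>i<m. max (h $ i - \<beta> * \<gamma>) 0 / \<beta> * (v \<bullet> yh (\<beta> \<cdot>\<^sub>v unit_vec m i)))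
      + v \<bullet> yh ((\<beta> * \<gamma>) \<cdot>\<^sub>v ones_vec m)"
proof -
  let ?f = "\<lambda>i. max (h $ i - \<beta> * \<gamma>) 0 \<cdot>\<^sub>v yh (\<beta> \<cdot>\<^sub>v unit_vec m i)"
  have f: "?f \<in> {..<m} \<rightarrow> carrier_vec n" using assms by auto
  have "v \<bullet> pw_affine_y m n \<beta> \<gamma> yh h =
      (1 / \<beta>) * (v \<bullet> finsum_vec TYPE(real) n ?f {..<m}) + v \<bullet> yh ((\<beta> * \<gamma>) \<cdot>\<^sub>v ones_vec m)"
    unfolding pw_affine_y_def using assms finsum_vec_closed[OF f]
    by (subst scalar_prod_add_distrib[where n = n]) auto
  also have "v \<bullet> finsum_vec TYPE(real) n ?f {..<m}
      = (\<Sum>i<m. max (h $ i - \<beta> * \<gamma>) 0 * (v \<bullet> yh (\<beta> \<cdot>\<^sub>v unit_vec m i)))"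
    using assms by (subst scalar_prod_finsum_vec[OF _ f]) (auto intro!: sum.cong)
  finally show ?thesis by (simp add: sum_distrib_left)
qed

lemma pw_affine_y_nonneg:
  assumes "0 < \<beta>" "\<And>i. i < m \<Longrightarrow> yh (\<beta> \<cdot>\<^sub>v unit_vec m i) \<in> nonneg_orthant n"
    and "yh ((\<beta> * \<gamma>) \<cdot>\<^sub>v ones_vec m) \<in> nonneg_orthant n"
  shows "pw_affine_y m n \<beta> \<gamma> yh h \<in> nonneg_orthant n"
proof -
  let ?f = "\<lambda>i. max (h $ i - \<beta> * \<gamma>) 0 \<cdot>\<^sub>v yh (\<beta> \<cdot>\<^sub>v unit_vec m i)"
  have f: "?f \<in> {..<m} \<rightarrow> carrier_vec n" using assms nonneg_orthant_carrier by auto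
  have "finsum_vec TYPE(real) n ?f {..<m} \<in> nonneg_orthant n"
    using assms finsum_vec_closed[OF f]
    by (auto simp: nonneg_orthant_iff index_finsum_vec[OF _ _ f] intro!: sum_nonneg)
  then show ?thesis unfolding pw_affine_y_def
    using assms by (intro add_nonneg_orthant smult_nonneg_orthant) auto
qed

text \<open>With the normalised excesses \<open>l i\<close> as weights, the constraints at the
  points \<open>\<beta> * e_i\<close> cover \<open>h - \<beta> * \<gamma> * e\<close> and use at
  most one copy of \<open>A * xh\<close>, because the weights sum up to at most 1. The constraint at
  \<open>\<beta> * \<gamma> * e\<close> covers the rest with a second copy. Hence the first stage
  \<open>2 * xh\<close>.\<close>

lemma pw_affine_feasible:
  assumes data: "ar_data m n A B c d" and b: "0 < \<beta>"
    and feas: "ar_feasible A B (scale_set \<beta> (simplex_conv m \<gamma>)) xh yh"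
    and U: "U \<subseteq> nonneg_orthant m"
    and excess: "\<And>h. h \<in> U \<Longrightarrow> (\<Sum>i<m. max (h $ i - \<beta> * \<gamma>) 0) \<le> \<beta>"
  shows "ar_feasible A B U (pw_affine_x xh) (pw_affine_y m n \<beta> \<gamma> yh)"
  unfolding ar_feasible_def
proof (intro conjI ballI)
  have A: "A \<in> carrier_mat m n" "\<forall>i<m. \<forall>j<n. 0 \<le> A $$ (i, j)" and B: "B \<in> carrier_mat m n"
    using data by (auto simp: ar_data_def)
  have x: "xh \<in> nonneg_orthant n"
    and sol: "yh h \<in> nonneg_orthant n \<and> h \<le> A *\<^sub>v xh + B *\<^sub>v yh h"
    if "h \<in> scale_set \<beta> (simplex_conv m \<gamma>)" for h
    using feas that A B by (auto simp: ar_feasible_def)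
  have mem: "\<beta> \<cdot>\<^sub>v unit_vec m i \<in> scale_set \<beta> (simplex_conv m \<gamma>)" if "i < m" for i
    using simplex_conv_mem that by (auto simp: scale_set_def)
  have "(\<beta> * \<gamma>) \<cdot>\<^sub>v ones_vec m = \<beta> \<cdot>\<^sub>v (\<gamma> \<cdot>\<^sub>v ones_vec m)"
    by (simp add: smult_smult_assoc)
  then have mem_ones: "(\<beta> * \<gamma>) \<cdot>\<^sub>v ones_vec m \<in> scale_set \<beta> (simplex_conv m \<gamma>)"
    using simplex_conv_mem(2) by (auto simp: scale_set_def)
  note x = x[OF mem_ones]
  show "pw_affine_x xh \<in> nonneg_orthant (dim_col A)"
    using x A by (auto simp: pw_affine_x_def intro: smult_nonneg_orthant)
  fix h assume h: "h \<in> U"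
  show y: "pw_affine_y m n \<beta> \<gamma> yh h \<in> nonneg_orthant (dim_col B)"
    using sol mem mem_ones b B by (auto intro!: pw_affine_y_nonneg)
  show "h \<le> A *\<^sub>v pw_affine_x xh + B *\<^sub>v pw_affine_y m n \<beta> \<gamma> yh h"
    unfolding less_eq_vec_def
  proof (intro conjI allI impI)
    show "dim_vec h = dim_vec (A *\<^sub>v pw_affine_x xh + B *\<^sub>v pw_affine_y m n \<beta> \<gamma> yh h)"
      using h U B by (auto simp: nonneg_orthant_iff)
  next
    fix j assume "j < dim_vec (A *\<^sub>v pw_affine_x xh + B *\<^sub>v pw_affine_y m n \<beta> \<gamma> yh h)"
    then have j: "j < m" using B by simp
    define a where "a = row A j \<bullet> xh"
    define l where "l i = max (h $ i - \<beta> * \<gamma>) 0 / \<beta>" for i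
    have a: "0 \<le> a"
      unfolding a_def using row_nonneg_orthant[OF A j] x by (rule scalar_prod_nonneg)
    have l: "0 \<le> l i" for i using b by (simp add: l_def)
    have l_sum: "(\<Sum>i<m. l i) \<le> 1"
      using excess[OF h] b by (simp add: l_def flip: sum_divide_distrib)
    have at: "g $ j \<le> a + row B j \<bullet> yh g" if "g \<in> scale_set \<beta> (simplex_conv m \<gamma>)" for g
      using sol[OF that] j A B by (auto simp: less_eq_vec_def a_def)
    \<comment> \<open>Row \<open>j\<close> of the constraint at \<open>\<beta> * e_i\<close>, with
      \<open>a\<close> moved to the left and both sides scaled by \<open>l i\<close>. Summed over
      \<open>i\<close>, only \<open>i = j\<close> keeps its \<open>\<beta>\<close>.\<close>
    have "l i * (\<beta> * (if j = i then 1 else 0) - a) \<le> l i * (row B j \<bullet> yh (\<beta> \<cdot>\<^sub>v unit_vec m i))"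
      if "i < m" for i
      using at[OF mem[OF that]] that j l[of i] by (intro mult_left_mono) auto
    then have "(\<Sum>i<m. l i * (\<beta> * (if j = i then 1 else 0) - a))
        \<le> (\<Sum>i<m. l i * (row B j \<bullet> yh (\<beta> \<cdot>\<^sub>v unit_vec m i)))"
      by (intro sum_mono) auto
    moreover have "(\<Sum>i<m. l i * (\<beta> * (if j = i then 1 else 0) - a)) = l j * \<beta> - (\<Sum>i<m. l i) * a"
    proof -
      have "l i * (\<beta> * (if j = i then 1 else 0) - a) = (if j = i then l i * \<beta> else 0) - l i * a" for i
        by (simp add: algebra_simps)
      then show ?thesis using j by (simp add: sum_subtractf sum_distrib_right)
    qed
    \<comment> \<open>The nonnegativity of \<open>A\<close> enters here, through
      \<open>0 \<le> a\<close>.\<close>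
    moreover have "(\<Sum>i<m. l i) * a \<le> a" using l_sum a by (simp add: mult_left_le_one_le sum_nonneg l)
    moreover have "h $ j - \<beta> * \<gamma> \<le> l j * \<beta>" using b by (simp add: l_def)
    moreover have "\<beta> * \<gamma> \<le> a + row B j \<bullet> yh ((\<beta> * \<gamma>) \<cdot>\<^sub>v ones_vec m)"
      using at[OF mem_ones] j by (simp add: ones_vec_def)
    moreover have "row B j \<bullet> pw_affine_y m n \<beta> \<gamma> yh h =
        (\<Sum>i<m. l i * (row B j \<bullet> yh (\<beta> \<cdot>\<^sub>v unit_vec m i)))
        + row B j \<bullet> yh ((\<beta> * \<gamma>) \<cdot>\<^sub>v ones_vec m)"
      unfolding l_def using B sol mem mem_ones j
      by (intro scalar_prod_pw_affine_y) (auto intro: nonneg_orthant_carrier)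
    moreover have "row A j \<bullet> pw_affine_x xh = 2 * a"
      using x A j by (simp add: pw_affine_x_def a_def nonneg_orthant_iff)
    ultimately have "h $ j \<le> row A j \<bullet> pw_affine_x xh + row B j \<bullet> pw_affine_y m n \<beta> \<gamma> yh h"
      by linarith
    then show "h $ j \<le> (A *\<^sub>v pw_affine_x xh + B *\<^sub>v pw_affine_y m n \<beta> \<gamma> yh h) $ j"
      using A B j by simp
  qed
qed

text \<open>Every value of \<open>yh\<close> on the scaled hull costs at most the supremum
  \<open>r\<close>. The weighted values thus cost at most \<open>r\<close>, as the weights sum up to
  at most 1, and the value at \<open>\<beta> * \<gamma> * e\<close> costs at most another
  \<open>r\<close>; the first-stage cost doubles too.\<close>

lemma pw_affine_cost_le:
  assumes data: "ar_data m n A B c d" and b: "0 < \<beta>"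
    and feas: "ar_feasible A B (scale_set \<beta> (simplex_conv m \<gamma>)) xh yh"
    and excess: "(\<Sum>i<m. max (h $ i - \<beta> * \<gamma>) 0) \<le> \<beta>"
  shows "ereal (c \<bullet> pw_affine_x xh + d \<bullet> pw_affine_y m n \<beta> \<gamma> yh h)
    \<le> 2 * ar_cost c d (scale_set \<beta> (simplex_conv m \<gamma>)) xh yh"
proof -
  let ?S = "scale_set \<beta> (simplex_conv m \<gamma>)"
  have c: "c \<in> nonneg_orthant n" and d: "d \<in> nonneg_orthant n"
    and dims: "dim_col A = n" "dim_col B = n"
    using data by (auto simp: ar_data_def)
  have x: "xh \<in> nonneg_orthant n" and y: "\<And>h. h \<in> ?S \<Longrightarrow> yh h \<in> nonneg_orthant n"
    using feas dims by (auto simp: ar_feasible_def)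
  have mem: "\<beta> \<cdot>\<^sub>v unit_vec m i \<in> ?S" if "i < m" for i
    using simplex_conv_mem that by (auto simp: scale_set_def)
  have "(\<beta> * \<gamma>) \<cdot>\<^sub>v ones_vec m = \<beta> \<cdot>\<^sub>v (\<gamma> \<cdot>\<^sub>v ones_vec m)"
    by (simp add: smult_smult_assoc)
  then have mem_ones: "(\<beta> * \<gamma>) \<cdot>\<^sub>v ones_vec m \<in> ?S"
    using simplex_conv_mem(2) by (auto simp: scale_set_def)
  define M where "M = (SUP h\<in>?S. ereal (d \<bullet> yh h))"
  have M: "ereal (d \<bullet> yh g) \<le> M" if "g \<in> ?S" for g
    unfolding M_def using that by (rule SUP_upper)
  have cx: "c \<bullet> pw_affine_x xh = 2 * (c \<bullet> xh)"
    using c x by (simp add: pw_affine_x_def nonneg_orthant_iff)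
  \<comment> \<open>The supremum is an extended real: at infinity the bound is trivial, and minus
    infinity is excluded because the set contains \<open>\<beta> * \<gamma> * e\<close>.\<close>
  show ?thesis
  proof (cases M)
    case (real r)
    have le: "d \<bullet> yh g \<le> r" if "g \<in> ?S" for g using M[OF that] real by simp
    have r: "0 \<le> r" using le[OF mem_ones] scalar_prod_nonneg[OF d y[OF mem_ones]] by simp
    have "d \<bullet> pw_affine_y m n \<beta> \<gamma> yh h =
        (\<Sum>i<m. max (h $ i - \<beta> * \<gamma>) 0 / \<beta> * (d \<bullet> yh (\<beta> \<cdot>\<^sub>v unit_vec m i)))
        + d \<bullet> yh ((\<beta> * \<gamma>) \<cdot>\<^sub>v ones_vec m)"
      using d y mem mem_ones
      by (intro scalar_prod_pw_affine_y) (auto intro: nonneg_orthant_carrier)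
    also have "\<dots> \<le> (\<Sum>i<m. max (h $ i - \<beta> * \<gamma>) 0 / \<beta> * r) + r"
      using le mem mem_ones b by (intro add_mono sum_mono mult_left_mono) auto
    also have "(\<Sum>i<m. max (h $ i - \<beta> * \<gamma>) 0 / \<beta> * r) = (\<Sum>i<m. max (h $ i - \<beta> * \<gamma>) 0) / \<beta> * r"
      by (simp add: sum_divide_distrib sum_distrib_right)
    also have "\<dots> \<le> 1 * r" using excess b r by (intro mult_right_mono) auto
    finally have "d \<bullet> pw_affine_y m n \<beta> \<gamma> yh h \<le> 2 * r" by simp
    moreover have "2 * ar_cost c d ?S xh yh = ereal (2 * (c \<bullet> xh + r))"
      unfolding ar_cost_def M_def[symmetric] real by (simp add: numeral_eq_ereal)
    ultimately show ?thesis using cx by simp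
  next
    case PInf
    then show ?thesis unfolding ar_cost_def M_def[symmetric] by simp
  next
    case MInf
    then show ?thesis using M[OF mem_ones] by simp
  qed
qed

section \<open>Comparison of optimal values and the approximation factor\<close>

text \<open>Constraints and costs are homogeneous: if \<open>g h\<close> is a point of
  \<open>U\<close> with \<open>h\<close> below \<open>r\<close> times \<open>g h\<close>, then a
  solution \<open>(x, y)\<close> for \<open>U\<close> gives the solution \<open>r * x\<close>,
  \<open>r * y (g h)\<close> for \<open>S\<close>, at no more than \<open>r\<close> times the
  cost.\<close>

lemma z_AR_le_scaled:
  assumes data: "ar_data m n A B c d" and r: "0 < r" and U: "U \<subseteq> carrier_vec m"
    and cover: "\<forall>h\<in>S. \<exists>h'\<in>U. h \<le> r \<cdot>\<^sub>v h'"
  shows "z_AR A B c d S \<le> ereal r * z_AR A B c d U"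
proof -
  have A: "A \<in> carrier_mat m n" and B: "B \<in> carrier_mat m n"
    and c: "c \<in> carrier_vec n" and d: "d \<in> carrier_vec n"
    using data by (auto simp: ar_data_def nonneg_orthant_carrier)
  from bchoice[OF cover[unfolded Bex_def]]
  obtain g where g: "\<And>h. h \<in> S \<Longrightarrow> g h \<in> U" "\<And>h. h \<in> S \<Longrightarrow> h \<le> r \<cdot>\<^sub>v g h"
    by blast
  have bound: "z_AR A B c d S \<le> ereal r * ar_cost c d U x y" if feas: "ar_feasible A B U x y" for x y
  proof -
    have x: "x \<in> nonneg_orthant n" and y: "\<And>h. h \<in> U \<Longrightarrow> y h \<in> nonneg_orthant n"
      and le: "\<And>h. h \<in> U \<Longrightarrow> h \<le> A *\<^sub>v x + B *\<^sub>v y h"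
      using feas A B by (auto simp: ar_feasible_def)
    define x' y' where "x' = r \<cdot>\<^sub>v x" and "y' h = r \<cdot>\<^sub>v y (g h)" for h
    have "h \<le> A *\<^sub>v x' + B *\<^sub>v y' h" if h: "h \<in> S" for h
    proof -
      have "h \<le> r \<cdot>\<^sub>v g h" using g h by blast
      also have "\<dots> \<le> r \<cdot>\<^sub>v (A *\<^sub>v x + B *\<^sub>v y (g h))"
        using le[OF g(1)[OF h]] r by (auto simp: less_eq_vec_def)
      also have "\<dots> = A *\<^sub>v x' + B *\<^sub>v y' h"
        using x y[OF g(1)[OF h]] A B unfolding x'_def y'_def
        by (simp add: mult_mat_vec[OF A] mult_mat_vec[OF B] nonneg_orthant_carrier
            smult_add_distrib_vec[of _ m])
      finally show ?thesis .
    qed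
    then have "ar_feasible A B S x' y'"
      using x y g A B r by (auto simp: ar_feasible_def x'_def y'_def intro!: smult_nonneg_orthant)
    then have "z_AR A B c d S \<le> ar_cost c d S x' y'"
      unfolding z_AR_def by (intro Inf_lower) auto
    also have "ar_cost c d S x' y' \<le> ereal r * ereal (c \<bullet> x) + ereal r * (SUP h\<in>U. ereal (d \<bullet> y h))"
      unfolding ar_cost_def
    proof (intro add_mono SUP_least)
      show "ereal (c \<bullet> x') \<le> ereal r * ereal (c \<bullet> x)"
        using c x by (simp add: x'_def nonneg_orthant_iff)
    next
      fix h assume h: "h \<in> S"
      have "ereal (d \<bullet> y' h) = ereal r * ereal (d \<bullet> y (g h))"
        using d y[OF g(1)[OF h]] by (simp add: y'_def nonneg_orthant_iff)
      also have "\<dots> \<le> ereal r * (SUP h\<in>U. ereal (d \<bullet> y h))"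
        using r g(1)[OF h] by (intro ereal_mult_left_mono SUP_upper) auto
      finally show "ereal (d \<bullet> y' h) \<le> ereal r * (SUP h\<in>U. ereal (d \<bullet> y h))" .
    qed
    also have "\<dots> = ereal r * ar_cost c d U x y"
      unfolding ar_cost_def by (subst ereal_distrib_left) auto
    finally show ?thesis .
  qed
  \<comment> \<open>Dividing by \<open>r\<close> turns \<open>bound\<close> into a lower bound for
    all costs over \<open>U\<close>. An infeasible problem over \<open>U\<close> is included, as its
    set of costs is empty.\<close>
  have "z_AR A B c d S / ereal r \<le> z_AR A B c d U"
    unfolding z_AR_def[of A B c d U]
  proof (rule Inf_greatest)
    fix z assume "z \<in> {ar_cost c d U x y | x y. ar_feasible A B U x y}"
    then show "z_AR A B c d S / ereal r \<le> z"
      using bound r by (auto simp: ereal_divide_le_pos)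
  qed
  then show ?thesis using r by (simp add: ereal_divide_le_pos)
qed

text \<open>The factor \<open>2 * \<beta>\<close> is the product of the 2 from
  \<open>pw_affine_cost_le\<close> and the \<open>\<beta>\<close> from
  \<open>z_AR_le_scaled\<close>, the latter applied to the inclusion of the scaled hull in
  \<open>U\<close> scaled by \<open>\<beta>\<close>.\<close>

lemma pw_affine_approximation:
  assumes data: "ar_data m n A B c d" and b: "0 < \<beta>"
    and opt: "ar_optimal A B c d (scale_set \<beta> (simplex_conv m \<gamma>)) xh yh"
    and U: "U \<subseteq> nonneg_orthant m" and sub: "simplex_conv m \<gamma> \<subseteq> U"
    and excess: "\<And>h. h \<in> U \<Longrightarrow> (\<Sum>i<m. max (h $ i - \<beta> * \<gamma>) 0) \<le> \<beta>"
  shows "ar_approximation (2 * \<beta>) A B c d U (pw_affine_x xh) (pw_affine_y m n \<beta> \<gamma> yh)"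
  unfolding ar_approximation_def
proof (intro conjI ballI)
  let ?S = "scale_set \<beta> (simplex_conv m \<gamma>)"
  have feas: "ar_feasible A B ?S xh yh" and cost: "ar_cost c d ?S xh yh = z_AR A B c d ?S"
    using opt by (auto simp: ar_optimal_def)
  show "ar_feasible A B U (pw_affine_x xh) (pw_affine_y m n \<beta> \<gamma> yh)"
    by (rule pw_affine_feasible[OF data b feas U excess])
  fix h assume h: "h \<in> U"
  have "ereal (c \<bullet> pw_affine_x xh + d \<bullet> pw_affine_y m n \<beta> \<gamma> yh h) \<le> 2 * z_AR A B c d ?S"
    using pw_affine_cost_le[OF data b feas excess[OF h]] cost by simp
  also have "\<dots> \<le> 2 * (ereal \<beta> * z_AR A B c d U)"
    using U sub b
    by (intro ereal_mult_left_mono z_AR_le_scaled[OF data b])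
      (auto simp: scale_set_def nonneg_orthant_carrier)
  also have "\<dots> = ereal (2 * \<beta>) * z_AR A B c d U"
    by (simp add: mult.assoc[symmetric] numeral_eq_ereal)
  finally show "ereal (c \<bullet> pw_affine_x xh + d \<bullet> pw_affine_y m n \<beta> \<gamma> yh h)
    \<le> ereal (2 * \<beta>) * z_AR A B c d U" .
qed

section \<open>Convexity of the p-ball and the hull inside it\<close>

text \<open>For nonzero points this is \<open>powr_convex\<close>. If one of them is 0, a single
  term remains and \<open>u powr p \<le> u\<close> on the unit interval, applied to its weight,
  suffices.\<close>

lemma powr_convex_nonneg:
  fixes a b s t p :: real
  assumes "1 \<le> p" "0 \<le> a" "0 \<le> b" "0 \<le> s" "0 \<le> t" "s + t = 1"
  shows "(s * a + t * b) powr p \<le> s * a powr p + t * b powr p"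
proof -
  have powr_le: "u powr p \<le> u" if "0 \<le> u" "u \<le> 1" for u :: real
    using powr_mono'[of 1 p u] that assms(1) by simp
  show ?thesis
  proof (cases "a = 0 \<or> b = 0")
    case True
    then show ?thesis
      using assms powr_le[of s] powr_le[of t] by (auto simp: powr_mult intro!: mult_right_mono)
  next
    case False
    then show ?thesis
      using convex_onD[OF powr_convex[OF assms(1)], of t a b] assms
      by (simp add: eq_diff_eq[symmetric])
  qed
qed

text \<open>On the orthant the absolute values disappear, and the outer power \<open>1 / p\<close>
  is monotone and fixes 1. In this form without the root, membership is a bound on a sum over
  coordinates.\<close>

lemma p_ball_iff:
  assumes "1 \<le> p"
  shows "h \<in> p_ball p m \<longleftrightarrow> h \<in> nonneg_orthant m \<and> (\<Sum>i<m. h $ i powr p) \<le> 1"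
proof -
  have "p_norm p h = (\<Sum>i<m. h $ i powr p) powr (1 / p)" if "h \<in> nonneg_orthant m"
    using that by (simp add: p_norm_def nonneg_orthant_iff)
  moreover have "s powr (1 / p) \<le> 1 \<longleftrightarrow> s \<le> 1" if "0 \<le> s" for s :: real
    using that assms powr_less_mono2[of "1/p" 1 s] powr_mono2[of "1/p" s 1]
    by (simp add: not_le[symmetric]) (meson not_le)
  moreover have "0 \<le> (\<Sum>i<m. h $ i powr p)" by (intro sum_nonneg) auto
  ultimately show ?thesis by (auto simp: p_ball_def)
qed

lemma convex_vec_p_ball:
  assumes p: "1 \<le> p"
  shows "convex_vec m (p_ball p m)"
  unfolding convex_vec_def
proof (intro conjI ballI allI impI)
  show "p_ball p m \<subseteq> carrier_vec m" by (auto simp: p_ball_def nonneg_orthant_carrier)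
next
  fix v w :: "real vec" and s t :: real
  assume v: "v \<in> p_ball p m" and w: "w \<in> p_ball p m" and st: "0 \<le> s" "0 \<le> t" "s + t = 1"
  have orth: "v \<in> nonneg_orthant m" "w \<in> nonneg_orthant m"
    and sums: "(\<Sum>i<m. v $ i powr p) \<le> 1" "(\<Sum>i<m. w $ i powr p) \<le> 1"
    using v w p_ball_iff[OF p] by auto
  have "(\<Sum>i<m. (s \<cdot>\<^sub>v v + t \<cdot>\<^sub>v w) $ i powr p) \<le> (\<Sum>i<m. s * v $ i powr p + t * w $ i powr p)"
    using orth st p by (intro sum_mono) (auto simp: nonneg_orthant_iff intro!: powr_convex_nonneg)
  also have "\<dots> = s * (\<Sum>i<m. v $ i powr p) + t * (\<Sum>i<m. w $ i powr p)"
    by (simp add: sum.distrib sum_distrib_left)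
  also have "\<dots> \<le> s * 1 + t * 1" using sums st by (intro add_mono mult_left_mono)
  finally show "s \<cdot>\<^sub>v v + t \<cdot>\<^sub>v w \<in> p_ball p m"
    using orth st p by (simp add: p_ball_iff add_nonneg_orthant smult_nonneg_orthant)
qed

text \<open>By convexity of the ball it is enough to check the vertices. The value of
  \<open>gamma\<close> is such that each coordinate of \<open>gamma * e\<close> contributes exactly
  \<open>1 / m\<close> to the sum of powers.\<close>

lemma simplex_conv_subset_p_ball:
  assumes p: "1 \<le> p" and m: "1 \<le> m"
  shows "simplex_conv m (gamma p m) \<subseteq> p_ball p m"
proof (intro simplex_conv_minimal convex_vec_p_ball[OF p])
  fix i assume i: "i < m"
  have "(\<Sum>j<m. unit_vec m i $ j powr p) = (\<Sum>j<m. if j = i then 1 else 0)"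
    using i by (intro sum.cong) auto
  then show "unit_vec m i \<in> p_ball p m"
    using i p by (auto simp: p_ball_iff nonneg_orthant_iff)
next
  have "gamma p m powr p = 1 / real m"
    using p m unfolding gamma_def powr_powr by (simp add: powr_minus_divide)
  then show "gamma p m \<cdot>\<^sub>v ones_vec m \<in> p_ball p m"
    using p m by (auto simp: p_ball_iff nonneg_orthant_iff ones_vec_def gamma_def)
qed

section \<open>Young's inequality and the choice of \<open>beta\<close>\<close>

lemma beta_pos: "1 \<le> p \<Longrightarrow> 1 \<le> m \<Longrightarrow> 0 < beta p m"
  by (auto simp: beta_def)

text \<open>The case \<open>1 < p\<close>, \<open>0 < t\<close> is Young's inequality with weights
  \<open>1 / p\<close> and \<open>q\<close>: the right side of
  \<open>t \<le> beta * t powr p + beta * gamma\<close> is a weighted arithmetic mean whose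
  geometric mean is exactly \<open>t\<close>.\<close>

lemma excess_le_powr:
  assumes p: "1 \<le> p" and m: "1 \<le> m" and t: "0 \<le> t"
  shows "max (t - beta p m * gamma p m) 0 \<le> beta p m * t powr p"
proof -
  have b: "0 < beta p m" using beta_pos[OF p m] .
  have g: "0 < gamma p m" using m by (simp add: gamma_def)
  have "t \<le> beta p m * t powr p + beta p m * gamma p m"
  \<comment> \<open>For \<open>p = 1\<close> the weight \<open>q\<close> would vanish, but then
    \<open>beta\<close> is 1 and the claim reads \<open>t \<le> t + gamma\<close>. For
    \<open>t = 0\<close> the right side is nonnegative.\<close>
  proof (cases "t = 0 \<or> p = 1")
    case True
    moreover have ?thesis if "p = 1" using that g t m by (simp add: beta_def)
    ultimately show ?thesis using b g by auto
  next
    case False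
    then have t: "0 < t" and p: "1 < p" using assms by auto
    define q where "q = (p - 1) / p"
    have q: "0 < q" "1 / p + q = 1" using p by (auto simp: q_def field_simps)
    \<comment> \<open>Weights for which the two terms on the right are the ones of Young's inequality.\<close>
    define X where "X = p * beta p m * t powr p"
    define Y where "Y = beta p m * gamma p m / q"
    have pb: "p * beta p m = (p - 1) powr q * real m powr (q / p)"
      using p by (simp add: beta_def q_def power2_eq_square)
    have Y: "Y = p * beta p m * (gamma p m / (p - 1))" using p by (simp add: Y_def q_def)
    \<comment> \<open>The exponents sum up to 1, so \<open>p * beta\<close> occurs to the first
      power. Its factor \<open>(p - 1) powr q\<close> cancels the denominator, and
      \<open>m powr (q / p)\<close> cancels \<open>gamma powr q\<close>; this is what determines
      \<open>beta\<close>.\<close>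
    have "X powr (1 / p) * Y powr q
        = (p * beta p m) powr (1 / p + q) * t * (gamma p m / (p - 1)) powr q"
      unfolding X_def Y powr_mult[of "p * beta p m" "t powr p"]
        powr_mult[of "p * beta p m" "gamma p m / (p - 1)"] powr_powr powr_add
      using p t by simp
    also have "\<dots> = t * ((p - 1) powr q * real m powr (q / p) * (gamma p m powr q / (p - 1) powr q))"
      using p b g m q(2) by (simp add: powr_divide pb)
    also have "\<dots> = t * (real m powr (q / p) * real m powr (- q / p))"
      using p by (simp add: gamma_def powr_powr)
    also have "\<dots> = t"
      using m by (simp flip: powr_add)
    finally have "t = X powr (1 / p) * Y powr q" by simp
    also have "\<dots> \<le> 1 / p * X + q * Y"
      using p q b g t by (intro Youngs_inequality_0) (auto simp: X_def Y_def)
    also have "\<dots> = beta p m * t powr p + beta p m * gamma p m"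
      using p q by (simp add: X_def Y_def)
    finally show ?thesis .
  qed
  then show ?thesis using b by simp
qed

text \<open>Summing the bound for single coordinates leaves \<open>beta\<close> times the sum of
  powers, which is at most 1 on the ball. This supplies the hypothesis \<open>excess\<close> of the
  general lemmas.\<close>

lemma p_ball_excess_le:
  assumes p: "1 \<le> p" and m: "1 \<le> m" and h: "h \<in> p_ball p m"
  shows "(\<Sum>i<m. max (h $ i - beta p m * gamma p m) 0) \<le> beta p m"
proof -
  have "(\<Sum>i<m. max (h $ i - beta p m * gamma p m) 0) \<le> (\<Sum>i<m. beta p m * h $ i powr p)"
    using h p m by (intro sum_mono excess_le_powr) (auto simp: p_ball_iff nonneg_orthant_iff)
  also have "\<dots> = beta p m * (\<Sum>i<m. h $ i powr p)" by (simp add: sum_distrib_left)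
  also have "\<dots> \<le> beta p m * 1"
    using h p beta_pos[OF p m] by (intro mult_left_mono) (auto simp: p_ball_iff)
  finally show ?thesis by simp
qed

theorem mainTheorem5:
  fixes p :: real
  assumes "1 \<le> p"
  shows "(\<lambda>m. beta p m) \<in> O(\<lambda>m. real m powr ((p - 1) / p\<^sup>2)) \<and>
    (\<forall>m\<ge>1. dominates m (scale_set (2 * beta p m) (simplex_conv m (gamma p m))) (p_ball p m)) \<and>
    (\<exists>C>0. \<forall>m\<ge>1. \<forall>n A B c d xh yh.
       ar_data m n A B c d \<longrightarrow>
       ar_optimal A B c d (scale_set (beta p m) (simplex_conv m (gamma p m))) xh yh \<longrightarrow>
       ar_approximation (C * real m powr ((p - 1) / p\<^sup>2)) A B c d (p_ball p m)
         (pw_affine_x xh) (pw_affine_y m n (beta p m) (gamma p m) yh))"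
proof (intro conjI)
  \<comment> \<open>\<open>K\<close> is the factor of \<open>beta\<close> that does not depend on
    \<open>m\<close>. The approximation factor \<open>2 * beta\<close> then yields the constant
    \<open>2 * K\<close>, which depends on \<open>p\<close> only.\<close>
  define K where "K = 1 / p * (if p = 1 then 1 else (p - 1) powr ((p - 1) / p))"
  have K: "0 < K" using assms by (auto simp: K_def)
  have beta: "beta p m = K * real m powr ((p - 1) / p\<^sup>2)" for m
    by (simp add: beta_def K_def)
  have orth: "p_ball p m \<subseteq> nonneg_orthant m" for m by (auto simp: p_ball_def)
  show "(\<lambda>m. beta p m) \<in> O(\<lambda>m. real m powr ((p - 1) / p\<^sup>2))"
    unfolding beta by simp
  show "\<forall>m\<ge>1. dominates m (scale_set (2 * beta p m) (simplex_conv m (gamma p m))) (p_ball p m)"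
    using assms orth
    by (intro allI impI dominates_simplex_conv beta_pos p_ball_excess_le) (auto simp: gamma_def)
  show "\<exists>C>0. \<forall>m\<ge>1. \<forall>n A B c d xh yh.
       ar_data m n A B c d \<longrightarrow>
       ar_optimal A B c d (scale_set (beta p m) (simplex_conv m (gamma p m))) xh yh \<longrightarrow>
       ar_approximation (C * real m powr ((p - 1) / p\<^sup>2)) A B c d (p_ball p m)
         (pw_affine_x xh) (pw_affine_y m n (beta p m) (gamma p m) yh)"
  proof (intro exI[of _ "2 * K"] conjI allI impI)
    show "0 < 2 * K" using K by simp
  next
    fix m n :: nat and A B :: "real mat" and c d xh :: "real vec" and yh :: "real vec \<Rightarrow> real vec"
    assume m: "1 \<le> m" and data: "ar_data m n A B c d"
      and opt: "ar_optimal A B c d (scale_set (beta p m) (simplex_conv m (gamma p m))) xh yh"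
    have "ar_approximation (2 * beta p m) A B c d (p_ball p m)
        (pw_affine_x xh) (pw_affine_y m n (beta p m) (gamma p m) yh)"
      using pw_affine_approximation[OF data beta_pos[OF assms m] opt orth
          simplex_conv_subset_p_ball[OF assms m] p_ball_excess_le[OF assms m]] .
    then show "ar_approximation (2 * K * real m powr ((p - 1) / p\<^sup>2)) A B c d (p_ball p m)
        (pw_affine_x xh) (pw_affine_y m n (beta p m) (gamma p m) yh)"
      by (simp add: beta mult.assoc)
  qed
qed

end
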